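(* Let $k\ge1$ and let $\mathcal S_k\subset\mathbb C$ be the group of $k$-th roots of unity. Let $(G,\sigma)$ be a finite connection graph, $G=(V,E)$, with a $k$-cyclic group connection $\sigma:E^{or}\to\mathcal S_k$, and let $\pi:V\to\mathbb R_{>0}$ be a vertex measure. Then $$\lambda_\infty^\sigma\ \ge\ \left(\sqrt{1+\tfrac12\,h^\sigma_{out}}-1\right)^2.$$
   Context: $G=(V,E)$ is a finite undirected graph, possibly with self-loops; $x\sim y$ means $\{x,y\}\in E$ ($x\sim x$ if there is a self-loop at $x$). Let $E^{or}=\{(x,y),(y,x):\{x,y\}\in E,\ x\ne y\}\cup\{(x,x):\{x,x\}\in E\}$. A $k$-cyclic group connection is a map $\sigma:E^{or}\to\mathcal S_k=\{1,\xi,\dots,\xi^{k-1}\}$, where $\xi$ is a primitive $k$-th root of unity, such that $\sigma_{xy}=\sigma_{yx}^{-1}$ for each $\{x,y\}\in E$. For $A\subseteq V$, $\pi(A)=\sum_{x\in A}\pi(x)$. A supremum (of nonnegative quantities) over the empty set is $0$. $\lambda_\infty^\sigma$ is the optimal (largest) constant such that for all $f:V\to\mathbb C$, $$\lambda_\infty^\sigma\sum_{x\in V}|f(x)|^2\pi(x)\le\sum_{x\in V}\sup_{y:y\sim x}|f(x)-\sigma_{xy}f(y)|^2\pi(x).$$ For $V_1\subseteq V$: $\partial_{out}(V_1)=\{y\in V\setminus V_1:\exists\,x\in V_1,\ x\sim y\}$ and $$\iota_\infty^{\sigma,\pi}(V_1)=\min_{\tau:V_1\to\mathcal S_k}\frac12\sum_{x\in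 V_1}\ \sup_{y\in V_1,\,y\sim x}|\tau(x)-\sigma_{xy}\tau(y)|\,\pi(x),\qquad h_{out}^\sigma=\min_{\emptyset\ne V_1\subseteq V}\frac{2\iota_\infty^{\sigma,\pi}(V_1)+\pi(\partial_{out}(V_1))}{\pi(V_1)}.$$ *)

theory Defs
  imports "HOL-Analysis.Analysis"
begin

text \<open>Undirected graphs with self-loops: the edge set is a set of unordered pairs \<open>{x, y}\<close> of
  vertices, and a self-loop at \<open>x\<close> is the edge \<open>{x, x} = {x}\<close>.\<close>

definition finite_graph :: "'v set \<Rightarrow> 'v set set \<Rightarrow> bool" where
  "finite_graph V E \<longleftrightarrow> finite V \<and> V \<noteq> {} \<and> E \<subseteq> {{x, y} |x y. x \<in> V \<and> y \<in> V}"

definition adj :: "'v set set \<Rightarrow> 'v \<Rightarrow> 'v \<Rightarrow> bool" where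
  "adj E x y \<longleftrightarrow> {x, y} \<in> E"

definition oriented_edges :: "'v set set \<Rightarrow> ('v \<times> 'v) set" where
  "oriented_edges E = {(x, y). {x, y} \<in> E}"

definition roots_of_unity :: "nat \<Rightarrow> complex set" where
  "roots_of_unity k = {z. z ^ k = 1}"

text \<open>Only the values of \<open>\<sigma>\<close> on oriented edges are constrained (and used).\<close>

definition cyclic_connection :: "nat \<Rightarrow> 'v set set \<Rightarrow> ('v \<Rightarrow> 'v \<Rightarrow> complex) \<Rightarrow> bool" where
  "cyclic_connection k E \<sigma> \<longleftrightarrow>
     (\<forall>(x, y)\<in>oriented_edges E. \<sigma> x y \<in> roots_of_unity k) \<and>
     (\<forall>x y. {x, y} \<in> E \<longrightarrow> \<sigma> x y = inverse (\<sigma> y x))"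

text \<open>Supremum of nonnegative reals, with value \<open>0\<close> on the empty index set (where \<open>Sup\<close> on the
  reals is unspecified).\<close>

definition sup_nonneg :: "'a set \<Rightarrow> ('a \<Rightarrow> real) \<Rightarrow> real" where
  "sup_nonneg A g = (if A = {} then 0 else (SUP y\<in>A. g y))"

definition lambda_inf_admissible ::
    "'v set \<Rightarrow> 'v set set \<Rightarrow> ('v \<Rightarrow> 'v \<Rightarrow> complex) \<Rightarrow> ('v \<Rightarrow> real) \<Rightarrow> real \<Rightarrow> bool" where
  "lambda_inf_admissible V E \<sigma> \<pi> c \<longleftrightarrow>
     (\<forall>f :: 'v \<Rightarrow> complex.
        c * (\<Sum>x\<in>V. (cmod (f x))\<^sup>2 * \<pi> x)
        \<le> (\<Sum>x\<in>V. sup_nonneg {y\<in>V. adj E y x} (\<lambda>y. (cmod (f x - \<sigma> x y * f y))\<^sup>2) * \<pi> x))"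

text \<open>The largest admissible constant; it exists by \<open>lambda_inf_greatest\<close> below.\<close>

definition lambda_inf ::
    "'v set \<Rightarrow> 'v set set \<Rightarrow> ('v \<Rightarrow> 'v \<Rightarrow> complex) \<Rightarrow> ('v \<Rightarrow> real) \<Rightarrow> real" where
  "lambda_inf V E \<sigma> \<pi> = (GREATEST c. lambda_inf_admissible V E \<sigma> \<pi> c)"

definition boundary_out :: "'v set \<Rightarrow> 'v set set \<Rightarrow> 'v set \<Rightarrow> 'v set" where
  "boundary_out V E V1 = {y \<in> V - V1. \<exists>x\<in>V1. adj E x y}"

text \<open>The extensional function space makes the set of maps \<open>V1 \<rightarrow> S\<^sub>k\<close> finite, so that \<open>Min\<close> is a
  genuine minimum.\<close>

definition iota_inf ::
    "nat \<Rightarrow> 'v set set \<Rightarrow> ('v \<Rightarrow> 'v \<Rightarrow> complex) \<Rightarrow> ('v \<Rightarrow> real) \<Rightarrow> 'v set \<Rightarrow> real" where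
  "iota_inf k E \<sigma> \<pi> V1 =
     (MIN \<tau>\<in>(V1 \<rightarrow>\<^sub>E roots_of_unity k).
        1 / 2 * (\<Sum>x\<in>V1. sup_nonneg {y\<in>V1. adj E y x} (\<lambda>y. cmod (\<tau> x - \<sigma> x y * \<tau> y)) * \<pi> x))"

definition h_out ::
    "nat \<Rightarrow> 'v set \<Rightarrow> 'v set set \<Rightarrow> ('v \<Rightarrow> 'v \<Rightarrow> complex) \<Rightarrow> ('v \<Rightarrow> real) \<Rightarrow> real" where
  "h_out k V E \<sigma> \<pi> =
     (MIN V1\<in>{V1. V1 \<noteq> {} \<and> V1 \<subseteq> V}.
        (2 * iota_inf k E \<sigma> \<pi> V1 + sum \<pi> (boundary_out V E V1)) / sum \<pi> V1)"

lemma lambda_inf_greatest: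
  assumes "finite_graph V E" and pos: "\<And>x. x \<in> V \<Longrightarrow> \<pi> x > 0"
  shows "lambda_inf_admissible V E \<sigma> \<pi> (lambda_inf V E \<sigma> \<pi>)"
    and "lambda_inf_admissible V E \<sigma> \<pi> c \<Longrightarrow> c \<le> lambda_inf V E \<sigma> \<pi>"
proof -
  let ?P = "lambda_inf_admissible V E \<sigma> \<pi>"
  let ?N = "\<lambda>f :: 'a \<Rightarrow> complex. \<Sum>x\<in>V. (cmod (f x))\<^sup>2 * \<pi> x"
  let ?R = "\<lambda>f :: 'a \<Rightarrow> complex.
    \<Sum>x\<in>V. sup_nonneg {y\<in>V. adj E y x} (\<lambda>y. (cmod (f x - \<sigma> x y * f y))\<^sup>2) * \<pi> x"
  have V: "finite V" "V \<noteq> {}" using assms(1) by (auto simp: finite_graph_def)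
  have N0: "?N f \<ge> 0" for f by (intro sum_nonneg mult_nonneg_nonneg) (auto simp: pos less_imp_le)
  have N1: "?N (\<lambda>_. 1) > 0" using V by (auto intro!: sum_pos pos)
  have sup0: "sup_nonneg {y\<in>V. adj E y x} (\<lambda>y. (cmod (f x - \<sigma> x y * f y))\<^sup>2) \<ge> 0" for f x
  proof (cases "{y\<in>V. adj E y x} = {}")
    case False
    then obtain y where y: "y \<in> {y\<in>V. adj E y x}" by blast
    have "0 \<le> (cmod (f x - \<sigma> x y * f y))\<^sup>2" by simp
    also have "\<dots> \<le> (SUP y\<in>{y\<in>V. adj E y x}. (cmod (f x - \<sigma> x y * f y))\<^sup>2)"
      using y V by (intro cSUP_upper bdd_above_finite) auto
    finally show ?thesis using False by (simp add: sup_nonneg_def)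
  qed (simp add: sup_nonneg_def)
  have P: "?P c \<longleftrightarrow> (\<forall>f. c * ?N f \<le> ?R f)" for c by (simp add: lambda_inf_admissible_def)
  have "?R f \<ge> 0" for f using sup0 by (intro sum_nonneg mult_nonneg_nonneg) (auto simp: pos less_imp_le)
  then have ne: "?P 0" by (simp add: P)
  have "c \<le> ?R (\<lambda>_. 1) / ?N (\<lambda>_. 1)" if "?P c" for c
    using that[unfolded P, rule_format, of "\<lambda>_. 1"] by (subst pos_le_divide_eq[OF N1])
  then have bdd: "bdd_above {c. ?P c}"
    by (intro bdd_aboveI[of _ "?R (\<lambda>_. 1) / ?N (\<lambda>_. 1)"]) (unfold mem_Collect_eq)
  define s where "s = Sup {c. ?P c}"
  have ub: "c \<le> s" if "?P c" for c unfolding s_def using that bdd by (intro cSup_upper) auto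
  have "s * ?N f \<le> ?R f" for f
  proof (cases "?N f = 0")
    case True
    then show ?thesis using ne[unfolded P, rule_format, of f] by simp
  next
    case False
    then have "?N f > 0" using N0[of f] by linarith
    then have "s \<le> ?R f / ?N f"
    proof (unfold s_def, intro cSup_least)
      show "{c. ?P c} \<noteq> {}" using ne by blast
      show "c \<le> ?R f / ?N f" if "c \<in> {c. ?P c}" for c
        using that[unfolded mem_Collect_eq P, rule_format, of f]
        by (subst pos_le_divide_eq[OF \<open>?N f > 0\<close>])
    qed
    then show ?thesis by (subst (asm) pos_le_divide_eq[OF \<open>?N f > 0\<close>])
  qed
  then have Ps: "?P s" by (simp add: P)
  have "lambda_inf V E \<sigma> \<pi> = s"
    unfolding lambda_inf_def by (rule Greatest_equality[of ?P, OF Ps ub])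
  then show "?P (lambda_inf V E \<sigma> \<pi>)" and "?P c \<Longrightarrow> c \<le> lambda_inf V E \<sigma> \<pi>"
    by (simp_all only: Ps ub)
qed

end

theory Submission
  imports Defs
begin

text \<open>Given \<open>f\<close>, put \<open>D(x)\<^sup>2 = sup |f x - \<sigma> x y * f y|\<^sup>2\<close>. On the level set \<open>{|f|\<^sup>2 > t}\<close> let \<open>\<tau>\<close> round
  the phase of \<open>f\<close> to a \<open>k\<close>-th root of unity, with sectors rotated by a uniformly random angle. All
  values \<open>\<sigma> x y * f y\<close> lie in the disc of radius \<open>D(x)\<close> about \<open>f x\<close>; if \<open>D(x) < |f x|\<close> that disc is
  seen from \<open>0\<close> under the half-angle \<open>\<alpha> = arcsin (D(x) / |f x|)\<close>, so by concavity of the sine the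
  expected supremum of \<open>|\<tau> x - \<sigma> x y * \<tau> y|\<close> is at most \<open>4 sin (\<alpha> / 2)\<close>, and otherwise it is at most
  \<open>2\<close>. Either way, integrating over \<open>t\<close> shows that \<open>x\<close> contributes at most \<open>2 |f x| D(x) + D(x)\<^sup>2\<close>
  to the frustration term. The outer boundary contributes at most
  \<open>(|f x| + D(x))\<^sup>2 - |f x|\<^sup>2\<close>, which is the same quantity. Hence
  \<open>h * \<Sum>|f|\<^sup>2\<pi> \<le> 2 * \<Sum>(2 |f| D + D\<^sup>2)\<pi>\<close>, and the arithmetic-geometric mean inequality finishes the
  proof.\<close>

section \<open>Integrals over rotations and levels\<close>

text \<open>A uniformly random shift makes the floor an unbiased rounding: it exceeds
  \<open>floor p\<close> by 1 on an interval of length \<open>frac p\<close>, which balances the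
  constant \<open>- frac p\<close>.\<close>

lemma has_integral_floor_shift:
  "((\<lambda>\<theta>. real_of_int \<lfloor>p + \<theta>\<rfloor> - p) has_integral 0) {0..1}"
proof -
  have r: "0 \<le> frac p" "frac p < 1" by (simp_all add: frac_lt_1)
  have 1: "((\<lambda>\<theta>. if \<theta> \<in> {1 - frac p..1} then 1 else 0) has_integral frac p) {0..1}"
    using has_integral_const_real[of "1::real" "1 - frac p" 1] r
    by (subst has_integral_restrict) auto
  have 2: "((\<lambda>\<theta> :: real. - frac p) has_integral - frac p) {0..1}"
    using has_integral_const_real[of "- frac p" 0 1] unfolding content_real_if by simp
  have "((\<lambda>\<theta>. (if \<theta> \<in> {1 - frac p..1} then 1 else 0) + - frac p) has_integral 0) {0..1}"
    using has_integral_add[OF 1 2] by simp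
  moreover have "(if \<theta> \<in> {1 - frac p..1} then 1 else 0) + - frac p = real_of_int \<lfloor>p + \<theta>\<rfloor> - p"
    if "\<theta> \<in> {0..1}" for \<theta>
  proof (cases "1 - frac p \<le> \<theta>")
    case True
    with that r have "\<lfloor>p + \<theta>\<rfloor> = \<lfloor>p\<rfloor> + 1"
      by (intro floor_unique) (auto simp: frac_def)
    with True that show ?thesis by (simp add: frac_def)
  next
    case False
    with that r have "\<lfloor>p + \<theta>\<rfloor> = \<lfloor>p\<rfloor>"
      unfolding frac_def atLeastAtMost_iff by linarith
    with False that show ?thesis by (simp add: frac_def)
  qed
  ultimately show ?thesis by (rule has_integral_eq[rotated])
qed

text \<open>A coarea inequality: integrate the hypothesis over all levels \<open>t\<close>.\<close>

lemma sum_level_sets_le: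
  fixes a b g M :: "'v \<Rightarrow> real"
  assumes g: "\<And>x. x \<in> V \<Longrightarrow> 0 \<le> g x" and M: "\<And>x. x \<in> V \<Longrightarrow> g x \<le> M x"
    and le: "\<And>t. 0 \<le> t \<Longrightarrow>
      (\<Sum>x\<in>V. if t < g x then a x else 0) \<le> (\<Sum>x\<in>V. if g x \<le> t \<and> t < M x then b x else 0)"
  shows "(\<Sum>x\<in>V. a x * g x) \<le> (\<Sum>x\<in>V. b x * (M x - g x))"
proof -
  have I: "has_bochner_integral lborel (indicator {c..<d} :: real \<Rightarrow> real) (d - c)" if "c \<le> d" for c d :: real
    using has_bochner_integral_real_indicator[of "{c..<d}" lborel] that by simp
  \<comment> \<open>The levels at which a vertex is counted form an interval, of length
    \<open>g x\<close> on the left and \<open>M x - g x\<close> on the right.\<close>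
  have A: "has_bochner_integral lborel (\<lambda>t. \<Sum>x\<in>V. a x * indicator {0..<g x} t) (\<Sum>x\<in>V. a x * (g x - 0))"
    by (intro has_bochner_integral_sum has_bochner_integral_mult_right I) (use g in auto)
  have B: "has_bochner_integral lborel (\<lambda>t. \<Sum>x\<in>V. b x * indicator {g x..<M x} t) (\<Sum>x\<in>V. b x * (M x - g x))"
    by (intro has_bochner_integral_sum has_bochner_integral_mult_right I) (use M in auto)
  have "(\<Sum>x\<in>V. a x * indicator {0..<g x} t) \<le> (\<Sum>x\<in>V. b x * indicator {g x..<M x} t)" for t
  proof (cases "0 \<le> t")
    case True
    have "(\<Sum>x\<in>V. a x * indicator {0..<g x} t) = (\<Sum>x\<in>V. if t < g x then a x else 0)"
      using True by (intro sum.cong) auto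
    also have "\<dots> \<le> (\<Sum>x\<in>V. if g x \<le> t \<and> t < M x then b x else 0)" by (rule le[OF True])
    also have "\<dots> = (\<Sum>x\<in>V. b x * indicator {g x..<M x} t)" by (intro sum.cong) auto
    finally show ?thesis .
  next
    case False
    then have "(\<Sum>x\<in>V. a x * indicator {0..<g x} t) = 0"
      by (intro sum.neutral) (auto simp: indicator_def)
    moreover have "(\<Sum>x\<in>V. b x * indicator {g x..<M x} t) = 0"
      using False g by (intro sum.neutral) (force simp: indicator_def)
    ultimately show ?thesis by simp
  qed
  then have "integral\<^sup>L lborel (\<lambda>t. \<Sum>x\<in>V. a x * indicator {0..<g x} t)
      \<le> integral\<^sup>L lborel (\<lambda>t. \<Sum>x\<in>V. b x * indicator {g x..<M x} t)"
    using A B by (intro integral_mono) (auto dest: integrable.intros)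
  then show ?thesis using A B by (simp add: has_bochner_integral_integral_eq)
qed

section \<open>Elementary bounds for sine and arcsine\<close>

text \<open>This is concavity of the sine on \<open>[0, pi]\<close>. The tangent criterion asks for
  an interior point, so \<open>x = 0\<close> is settled by \<open>sin y \<le> y\<close>.\<close>

lemma sin_le_tangent:
  assumes x: "0 \<le> x" "x < pi" and y: "0 \<le> y" "y \<le> pi"
  shows "sin y \<le> sin x + cos x * (y - x)"
proof (cases "x = 0")
  case True
  then show ?thesis using sin_x_le_x[OF y(1)] by simp
next
  case False
  with x have x0: "0 < x" by simp
  have "concave_on {0..pi} sin"
    unfolding concave_on_def
  proof (rule f''_ge0_imp_convex[where f' = "\<lambda>x. - cos x" and f'' = sin])
    show "0 \<le> sin u" if "u \<in> {0..pi}" for u :: real using that by (auto intro: sin_ge_zero)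
  qed (auto intro!: derivative_eq_intros)
  then have "convex_on {0..pi} (\<lambda>x. - sin x)" by (simp add: concave_on_def)
  then have "- cos x * (y - x) \<le> - sin y - - sin x"
    by (rule convex_on_imp_above_tangent)
       (use assms x0 in \<open>auto intro!: derivative_eq_intros is_interval_connected\<close>)
  then show ?thesis by simp
qed

text \<open>The tangents from 0 to the circle of radius \<open>d\<close> about 1 make the angle
  \<open>arcsin d\<close> with the real axis.\<close>

lemma abs_Arg_le_arcsin:
  assumes "cmod (\<zeta> - 1) \<le> d" "d < 1"
  shows "\<zeta> \<noteq> 0" "\<bar>Arg \<zeta>\<bar> \<le> arcsin d"
proof -
  have d0: "0 \<le> d" using assms(1) norm_ge_zero order_trans by blast
  have "1 - Re \<zeta> \<le> cmod (\<zeta> - 1)"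
    using abs_Re_le_cmod[of "\<zeta> - 1"] by simp
  then have Re: "Re \<zeta> > 0" using assms by linarith
  then show nz: "\<zeta> \<noteq> 0" by auto
  define x y where "x = Re \<zeta>" and "y = Im \<zeta>"
  have "(x - 1)\<^sup>2 + y\<^sup>2 \<le> d\<^sup>2"
    using power_mono[OF assms(1), of 2] by (simp add: cmod_power2 x_def y_def)
  then have "((x - 1)\<^sup>2 + y\<^sup>2) * (x\<^sup>2 + y\<^sup>2) \<le> d\<^sup>2 * (x\<^sup>2 + y\<^sup>2)"
    by (intro mult_right_mono) auto
  \<comment> \<open>Both sides are the squared modulus of
    \<open>cnj \<zeta> * (\<zeta> - 1)\<close>; dropping the last square leaves the bound on the
    sine of the phase.\<close>
  moreover have "((x - 1)\<^sup>2 + y\<^sup>2) * (x\<^sup>2 + y\<^sup>2) = y\<^sup>2 + (x\<^sup>2 + y\<^sup>2 - x)\<^sup>2"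
    by (simp add: power2_eq_square algebra_simps)
  ultimately have "y\<^sup>2 \<le> d\<^sup>2 * (x\<^sup>2 + y\<^sup>2)"
    using zero_le_power2[of "x\<^sup>2 + y\<^sup>2 - x"] by linarith
  then have "y\<^sup>2 \<le> (d * cmod \<zeta>)\<^sup>2" by (simp add: power_mult_distrib cmod_power2 x_def y_def)
  then have "\<bar>y\<bar> \<le> d * cmod \<zeta>" using d0 by (metis abs_le_square_iff abs_of_nonneg mult_nonneg_nonneg norm_ge_zero)
  moreover have "y = cmod \<zeta> * sin (Arg \<zeta>)"
    by (metis Im_rcis rcis_cmod_Arg y_def)
  ultimately have s: "\<bar>sin (Arg \<zeta>)\<bar> \<le> d"
    using nz by (simp add: abs_mult mult.commute)
  \<comment> \<open>The sine bound alone would also admit phases near \<open>pi\<close>; the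
    positive real part excludes them.\<close>
  have "\<bar>Arg \<zeta>\<bar> < pi / 2"
    using Re_Ln_pos_lt[OF nz] Re nz by (simp add: Arg_eq_Im_Ln)
  then have "\<bar>Arg \<zeta>\<bar> = arcsin (sin \<bar>Arg \<zeta>\<bar>)" by (subst arcsin_sin) auto
  also have "sin \<bar>Arg \<zeta>\<bar> \<le> d" using s by (simp add: abs_if split: if_splits)
  then have "arcsin (sin \<bar>Arg \<zeta>\<bar>) \<le> arcsin d"
    using assms d0 sin_ge_minus_one[of "\<bar>Arg \<zeta>\<bar>"] by (intro arcsin_le_arcsin) auto
  finally show "\<bar>Arg \<zeta>\<bar> \<le> arcsin d" .
qed

text \<open>With \<open>a = arcsin d / 2\<close>, so that \<open>d = 2 * sin a * cos a\<close>,
  removing the common factor \<open>4 * sin a\<close> leaves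
  \<open>1 - cos a \<le> sin a * (cos a) ^ 2\<close>.\<close>

lemma four_sin_half_arcsin_le:
  assumes "0 \<le> d" "d \<le> 1"
  shows "4 * sin (arcsin d / 2) \<le> 2 * d + d\<^sup>2"
proof -
  define a where "a = arcsin d / 2"
  have a: "0 \<le> a" "a \<le> pi / 4"
    using arcsin_bounded[of d] arcsin_nonneg[of d] assms by (auto simp: a_def)
  have d: "d = 2 * sin a * cos a"
    using assms sin_double[of a] by (simp add: a_def)
  have S: "0 \<le> sin a" "sin a \<le> 1" using a by (auto intro: sin_ge_zero)
  have C: "0 \<le> cos a" "cos a \<le> 1" using a by (auto intro: cos_ge_zero)
  have "cos (pi / 4) \<le> cos a" "sin a \<le> sin (pi / 4)"
    using a by (auto intro!: cos_monotone_0_pi_le sin_monotone_2pi_le)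
  then have SC: "sin a \<le> cos a" by (simp add: sin_45 cos_45)
  have pyth: "(sin a)\<^sup>2 + (cos a)\<^sup>2 = 1" by simp
  have "(sin a)\<^sup>2 \<le> (cos a)\<^sup>2" using SC S by (intro power_mono)
  then have C2: "(cos a)\<^sup>2 \<ge> 1 / 2" using pyth by linarith
  \<comment> \<open>The average of \<open>sin a \<le> 1\<close> and
    \<open>sin a \<le> cos a\<close>. The factor \<open>1 + cos a\<close> is wanted because it turns
    \<open>1 - cos a\<close> into \<open>sin a * sin a\<close>.\<close>
  have "sin a \<le> 1 / 2 * (1 + cos a)" using add_mono[OF S(2) SC] by simp
  also have "\<dots> \<le> (cos a)\<^sup>2 * (1 + cos a)" using C2 C by (intro mult_right_mono) auto
  finally have "sin a * sin a \<le> sin a * ((cos a)\<^sup>2 * (1 + cos a))" using S by (intro mult_left_mono)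
  moreover have "(1 - cos a) * (1 + cos a) = sin a * sin a"
    using sin_squared_eq[of a] by (simp add: power2_eq_square algebra_simps)
  ultimately have "(1 - cos a) * (1 + cos a) \<le> (sin a * (cos a)\<^sup>2) * (1 + cos a)"
    by (simp only: mult.assoc)
  then have "1 - cos a \<le> sin a * (cos a)\<^sup>2"
    using C mult_right_le_imp_le[of "1 - cos a" "1 + cos a"] by auto
  then have "4 * sin a * 1 \<le> 4 * sin a * (cos a + sin a * (cos a)\<^sup>2)"
    using S by (intro mult_left_mono) auto
  then show ?thesis
    unfolding a_def[symmetric] by (simp add: d power2_eq_square algebra_simps)
qed

section \<open>Roots of unity and rounded phases\<close>

text \<open>The \<open>k\<close> sectors of angle \<open>2\<pi>/k\<close>, rotated by \<open>\<theta>\<close> of a sector; the value at \<open>0\<close> is junk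
  (\<open>Arg 0 = 0\<close>).\<close>

definition round_phase :: "nat \<Rightarrow> real \<Rightarrow> complex \<Rightarrow> complex" where
  "round_phase k \<theta> z = cis (2 * pi / k * \<lfloor>k * Arg z / (2 * pi) + \<theta>\<rfloor>)"

lemma cis_2pi_div_power:
  assumes "k \<ge> 1"
  shows "cis (2 * pi / real k * real_of_int j) ^ k = 1"
proof -
  have "cis (2 * pi / real k * real_of_int j) ^ k = cis (real k * (2 * pi / real k * real_of_int j))"
    by (rule Complex.DeMoivre)
  also have "real k * (2 * pi / real k * real_of_int j) = 2 * pi * real_of_int j"
    using assms by simp
  finally show ?thesis by simp
qed

lemma round_phase_root: "k \<ge> 1 \<Longrightarrow> round_phase k \<theta> z \<in> roots_of_unity k"
  unfolding round_phase_def roots_of_unity_def mem_Collect_eq by (rule cis_2pi_div_power)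

lemma root_of_unity_norm: "\<lbrakk>k \<ge> 1; s \<in> roots_of_unity k\<rbrakk> \<Longrightarrow> cmod s = 1"
  using power_eq_imp_eq_base[of "cmod s" k 1] by (simp add: roots_of_unity_def flip: norm_power)

lemma root_of_unity_cis:
  assumes "k \<ge> 1" "s \<in> roots_of_unity k"
  obtains j :: int where "s = cis (2 * pi / k * j)"
proof -
  have "s \<in> (\<lambda>j. cis (2 * pi * real j / real k)) ` {..<k}"
    using assms bij_betw_imp_surj_on[OF Complex.bij_betw_roots_unity, of k]
    unfolding roots_of_unity_def by fastforce
  then obtain j where "s = cis (2 * pi * real j / real k)" by auto
  then show thesis using that[of "int j"] by (simp add: field_simps)
qed

lemma cmod_cis_diff: "cmod (cis x - cis y) = 2 * \<bar>sin ((y - x) / 2)\<bar>"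
proof -
  have "cis x - cis y = - cis x * (cis (y - x) - 1)"
    by (simp add: cis_mult right_diff_distrib)
  then show ?thesis
    using dist_exp_i_1[of "y - x"] by (simp add: norm_mult cis_conv_exp)
qed

text \<open>Multiplication by a \<open>k\<close>-th root of unity shifts sector indices by an
  integer and so commutes with rounding. What remains is the chord for the number of sector
  boundaries crossed in turning from \<open>z\<close> to \<open>s * w\<close>.\<close>

lemma round_phase_diff:
  assumes k: "k \<ge> 1" and s: "s \<in> roots_of_unity k" and z: "z \<noteq> 0" and w: "w \<noteq> 0"
  shows "cmod (round_phase k \<theta> z - s * round_phase k \<theta> w) =
    2 * \<bar>sin (pi / k * (\<lfloor>k * Arg z / (2 * pi) + \<theta> + k * Arg (s * w / z) / (2 * pi)\<rfloor>
                  - \<lfloor>k * Arg z / (2 * pi) + \<theta>\<rfloor>))\<bar>"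
proof -
  define u where "u z = real k * Arg z / (2 * pi)" for z
  obtain j :: int where j: "s = cis (2 * pi / k * j)" by (rule root_of_unity_cis[OF k s])
  have A: "Arg z' = 2 * pi / k * u z'" for z' using k by (simp add: u_def)
  have s0: "s \<noteq> 0" using j by auto
  have sw: "sgn (s * w / z) = s * sgn w / sgn z"
    unfolding j sgn_divide sgn_mult sgn_cis ..
  have "cis (Arg (s * w / z)) = cis (2 * pi / k * (j + u w - u z))"
  proof -
    have "cis (2 * pi / k * (j + u w - u z)) = cis (2 * pi / k * j) * cis (Arg w) / cis (Arg z)"
      by (simp only: A cis_mult cis_divide distrib_left right_diff_distrib)
    also have "\<dots> = cis (Arg (s * w / z))"
      unfolding j[symmetric] cis_Arg[OF z] cis_Arg[OF w] sw[symmetric]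
      using z w s0 by (intro cis_Arg[symmetric]) simp
    finally show ?thesis by (rule sym)
  qed
  \<comment> \<open>\<open>n\<close> accounts for the branch of \<open>Arg\<close>; it moves the
    sector index by a multiple of \<open>k\<close>, which \<open>cis\<close> does not see.\<close>
  then obtain n :: int where "Arg (s * w / z) = 2 * pi / k * (j + u w - u z) + 2 * pi * n"
    using sin_cos_eq_iff[of "Arg (s * w / z)" "2 * pi / k * (j + u w - u z)"]
    unfolding complex_eq_iff cis.sel by blast
  then have "2 * pi / k * u (s * w / z) = 2 * pi / k * (j + u w - u z + k * n)"
    using k by (simp add: A field_simps)
  then have "u (s * w / z) = j + u w - u z + k * n" using k by simp
  then have "u w + \<theta> = (u z + \<theta> + u (s * w / z)) + of_int (- j - k * n)" by simp
  then have fl: "\<lfloor>u w + \<theta>\<rfloor> = \<lfloor>u z + \<theta> + u (s * w / z)\<rfloor> + (- j - k * n)"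
    by (simp only: floor_add_int)
  define a b where "a = \<lfloor>u z + \<theta>\<rfloor>" and "b = \<lfloor>u z + \<theta> + u (s * w / z)\<rfloor>"
  have "s * round_phase k \<theta> w = cis (2 * pi / k * (j + \<lfloor>u w + \<theta>\<rfloor>))"
    by (simp add: round_phase_def j cis_mult u_def algebra_simps)
  also have "2 * pi / k * (j + \<lfloor>u w + \<theta>\<rfloor>) = 2 * pi / k * b + 2 * pi * of_int (- n)"
    unfolding fl b_def[symmetric] using k by (simp add: field_simps)
  also have "cis \<dots> = cis (2 * pi / k * b)"
    by (subst cis_mult[symmetric], subst cis_multiple_2pi) auto
  finally have "cmod (round_phase k \<theta> z - s * round_phase k \<theta> w)
      = cmod (cis (2 * pi / k * a) - cis (2 * pi / k * b))"
    by (simp add: round_phase_def a_def u_def)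
  also have "\<dots> = 2 * \<bar>sin (pi / k * (b - a))\<bar>"
    unfolding cmod_cis_diff by (simp add: right_diff_distrib diff_divide_distrib)
  finally show ?thesis by (simp add: a_def b_def u_def)
qed

text \<open>Jensen's inequality in pointwise form. The points \<open>s * w\<close> have phase within \<open>\<alpha>\<close> of \<open>z\<close>, so
  the jump \<open>j\<close> of the sector index is at most that of the extreme phases on either side, and
  \<open>2 sin (\<pi> j / k)\<close> is at most the tangent of \<open>2 sin\<close> at \<open>\<alpha> / 2\<close>. The bound is independent of
  \<open>w\<close>, and its floor terms vanish on averaging over \<open>\<theta>\<close>.\<close>

lemma round_phase_diff_le:
  assumes k: "k \<ge> 1" and s: "s \<in> roots_of_unity k" and D: "cmod (z - s * w) \<le> D" "D < cmod z"
  defines "\<alpha> \<equiv> arcsin (D / cmod z)"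
  shows "cmod (round_phase k \<theta> z - s * round_phase k \<theta> w) \<le> 4 * sin (\<alpha> / 2) +
    2 * cos (\<alpha> / 2) * (pi / k) *
      (\<lfloor>k * Arg z / (2 * pi) + k * \<alpha> / (2 * pi) + \<theta>\<rfloor> -
       \<lfloor>k * Arg z / (2 * pi) - k * \<alpha> / (2 * pi) + \<theta>\<rfloor> - 2 * (k * \<alpha> / (2 * pi)))"
proof -
  define v a where "v = k * Arg z / (2 * pi) + \<theta>" and "a = k * \<alpha> / (2 * pi)"
  have D0: "0 \<le> D" using D(1) norm_ge_zero order_trans by blast
  have z: "z \<noteq> 0" using D D0 by auto
  have d: "0 \<le> D / cmod z" "D / cmod z < 1" using D D0 z by (auto simp: divide_simps)
  have "s * w / z - 1 = - ((z - s * w) / z)" using z by (simp add: field_simps)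
  then have "cmod (s * w / z - 1) = cmod (z - s * w) / cmod z" by (simp add: norm_divide)
  also have "\<dots> \<le> D / cmod z" using D by (simp add: divide_right_mono)
  finally have \<zeta>: "cmod (s * w / z - 1) \<le> D / cmod z" .
  have w: "w \<noteq> 0" using abs_Arg_le_arcsin(1)[OF \<zeta> d(2)] by auto
  have \<alpha>: "0 \<le> \<alpha>" "\<alpha> \<le> pi / 2"
    using d arcsin_bounded[of "D / cmod z"] arcsin_nonneg[of "D / cmod z"] by (auto simp: \<alpha>_def)
  define t where "t = k * Arg (s * w / z) / (2 * pi)"
  have t: "\<bar>t\<bar> \<le> a"
    using mult_left_mono[OF abs_Arg_le_arcsin(2)[OF \<zeta> d(2)], of "real k / (2 * pi)"]
    by (simp add: t_def a_def \<alpha>_def abs_mult)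
  \<comment> \<open>This keeps the jumps \<open>p\<close> and \<open>m\<close> at most
    \<open>k\<close>, hence the angles \<open>pi / k * j\<close> in \<open>[0, pi]\<close>, where
    the sine is nonnegative and concave.\<close>
  have "real k * \<alpha> \<le> real k * (2 * pi)" using \<alpha> by (intro mult_left_mono) auto
  then have a: "0 \<le> a" "a \<le> k" using \<alpha> by (auto simp: a_def divide_simps)
  define T where "T j = 2 * sin (\<alpha> / 2) + 2 * cos (\<alpha> / 2) * (pi / k * real_of_int j - \<alpha> / 2)" for j
  have T_mono: "T i \<le> T j" if "i \<le> j" for i j
    unfolding T_def using that \<alpha> k
    by (intro add_left_mono mult_left_mono diff_right_mono mult_nonneg_nonneg cos_ge_zero) auto
  have sin_nn: "0 \<le> sin (pi / k * j)" and sin_T: "2 * sin (pi / k * j) \<le> T j"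
    if "0 \<le> j" "j \<le> int k" for j
  proof -
    have "pi / k * j \<le> pi / k * k" using that by (intro mult_left_mono) auto
    then have j: "0 \<le> pi / k * j" "pi / k * j \<le> pi" using that k by auto
    then show "0 \<le> sin (pi / k * j)" by (rule sin_ge_zero)
    show "2 * sin (pi / k * j) \<le> T j"
    proof -
      have "sin (pi / k * j) \<le> sin (\<alpha> / 2) + cos (\<alpha> / 2) * (pi / k * j - \<alpha> / 2)"
        by (rule sin_le_tangent) (use j \<alpha> pi_gt_zero in \<open>auto simp del: pi_gt_zero\<close>)
      then show ?thesis unfolding T_def by linarith
    qed
  qed
  define p m where "p = \<lfloor>v + a\<rfloor> - \<lfloor>v\<rfloor>" and "m = \<lfloor>v\<rfloor> - \<lfloor>v - a\<rfloor>"
  have p: "0 \<le> p" "p \<le> int k" and m: "0 \<le> m" "m \<le> int k"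
    using a unfolding p_def m_def by linarith+
  define J where "J = \<lfloor>v + t\<rfloor> - \<lfloor>v\<rfloor>"
  have J: "J \<le> p" "- m \<le> J" using t unfolding J_def p_def m_def by linarith+
  \<comment> \<open>Nonnegativity lets \<open>T p + T m\<close> dominate a jump in either direction;
    unlike a maximum, the sum is linear in the floors and can be averaged.\<close>
  have T_nn: "0 \<le> T p" "0 \<le> T m"
    using sin_nn[OF p] sin_T[OF p] sin_nn[OF m] sin_T[OF m] by linarith+
  have "2 * \<bar>sin (pi / k * J)\<bar> \<le> T p + T m"
  proof (cases "0 \<le> J")
    case True
    then have "2 * \<bar>sin (pi / k * J)\<bar> \<le> T J" using sin_nn[of J] sin_T[of J] J p by simp
    with T_mono[OF J(1)] T_nn show ?thesis by linarith
  next
    case False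
    then have "2 * \<bar>sin (pi / k * J)\<bar> \<le> T (- J)" using sin_nn[of "- J"] sin_T[of "- J"] J m by simp
    with T_mono[of "- J" m] J T_nn show ?thesis by linarith
  qed
  moreover have "cmod (round_phase k \<theta> z - s * round_phase k \<theta> w) = 2 * \<bar>sin (pi / k * J)\<bar>"
    using round_phase_diff[OF k s z w] by (simp add: J_def v_def t_def)
  moreover have "T p + T m = 4 * sin (\<alpha> / 2) + 2 * cos (\<alpha> / 2) * (pi / k) * (\<lfloor>v + a\<rfloor> - \<lfloor>v - a\<rfloor> - 2 * a)"
    using k by (simp add: T_def p_def m_def a_def field_simps)
  ultimately show ?thesis by (simp add: v_def a_def algebra_simps)
qed

section \<open>Suprema, \<open>iota_inf\<close> and \<open>h_out\<close>\<close>

lemma sup_nonneg_le: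
  assumes "0 \<le> c" "\<And>y. y \<in> A \<Longrightarrow> g y \<le> c"
  shows "sup_nonneg A g \<le> c"
  using assms by (auto simp: sup_nonneg_def intro: cSUP_least)

lemma sup_nonneg_ge:
  assumes "finite A" "y \<in> A"
  shows "g y \<le> sup_nonneg A g"
  using assms by (auto simp: sup_nonneg_def intro!: cSUP_upper)

lemma sup_nonneg_nonneg:
  assumes "finite A" "\<And>y. y \<in> A \<Longrightarrow> 0 \<le> g y"
  shows "0 \<le> sup_nonneg A g"
proof (cases "A = {}")
  case False
  then obtain y where "y \<in> A" by blast
  with assms sup_nonneg_ge[of A y g] show ?thesis by force
qed (simp add: sup_nonneg_def)

lemma finite_restricted_root_maps:
  assumes "finite V1" "k \<ge> 1"
  shows "finite (V1 \<rightarrow>\<^sub>E roots_of_unity k)" "V1 \<rightarrow>\<^sub>E roots_of_unity k \<noteq> {}"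
proof -
  show "finite (V1 \<rightarrow>\<^sub>E roots_of_unity k)"
    using assms finite_roots_unity[of k] by (intro finite_PiE) (auto simp: roots_of_unity_def)
  have "1 \<in> roots_of_unity k" by (simp add: roots_of_unity_def)
  then show "V1 \<rightarrow>\<^sub>E roots_of_unity k \<noteq> {}" by (auto simp: PiE_eq_empty_iff)
qed

lemma iota_inf_le:
  assumes "finite V1" "k \<ge> 1" "\<And>x. \<tau> x \<in> roots_of_unity k"
  shows "2 * iota_inf k E \<sigma> \<pi> V1 \<le>
    (\<Sum>x\<in>V1. sup_nonneg {y\<in>V1. adj E y x} (\<lambda>y. cmod (\<tau> x - \<sigma> x y * \<tau> y)) * \<pi> x)"
proof -
  let ?F = "\<lambda>\<tau>. 1 / 2 * (\<Sum>x\<in>V1. sup_nonneg {y\<in>V1. adj E y x} (\<lambda>y. cmod (\<tau> x - \<sigma> x y * \<tau> y)) * \<pi> x)"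
  \<comment> \<open>The minimum ranges over extensional maps only, while the sum sees
    \<open>\<tau>\<close> only on \<open>V1\<close>.\<close>
  have r: "restrict \<tau> V1 \<in> V1 \<rightarrow>\<^sub>E roots_of_unity k" using assms by auto
  have "iota_inf k E \<sigma> \<pi> V1 \<le> ?F (restrict \<tau> V1)"
    unfolding iota_inf_def
    by (rule Min_le[OF finite_imageI[OF finite_restricted_root_maps(1)[OF assms(1,2)]] imageI[OF r]])
  also have "?F (restrict \<tau> V1) = ?F \<tau>"
    by (intro arg_cong2[where f = "(*)"] sum.cong refl) (auto simp: sup_nonneg_def intro!: SUP_cong)
  finally show ?thesis by simp
qed

lemma iota_inf_nonneg:
  assumes "finite V1" "k \<ge> 1" "\<And>x. x \<in> V1 \<Longrightarrow> \<pi> x > 0"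
  shows "0 \<le> iota_inf k E \<sigma> \<pi> V1"
  unfolding iota_inf_def using finite_restricted_root_maps[OF assms(1,2)] assms
  by (subst Min_ge_iff)
     (auto intro!: mult_nonneg_nonneg sum_nonneg sup_nonneg_nonneg simp: less_imp_le)

lemma h_out_le:
  assumes "finite V" "V1 \<noteq> {}" "V1 \<subseteq> V" "\<And>x. x \<in> V \<Longrightarrow> \<pi> x > 0"
  shows "h_out k V E \<sigma> \<pi> * sum \<pi> V1 \<le> 2 * iota_inf k E \<sigma> \<pi> V1 + sum \<pi> (boundary_out V E V1)"
proof -
  have "sum \<pi> V1 > 0" using assms by (intro sum_pos) (auto intro: finite_subset)
  moreover have "h_out k V E \<sigma> \<pi> \<le> (2 * iota_inf k E \<sigma> \<pi> V1 + sum \<pi> (boundary_out V E V1)) / sum \<pi> V1"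
    unfolding h_out_def using assms by (intro Min_le) auto
  ultimately show ?thesis by (simp add: pos_le_divide_eq)
qed

lemma h_out_nonneg:
  assumes "finite V" "V \<noteq> {}" "k \<ge> 1" "\<And>x. x \<in> V \<Longrightarrow> \<pi> x > 0"
  shows "0 \<le> h_out k V E \<sigma> \<pi>"
proof -
  have "0 \<le> (2 * iota_inf k E \<sigma> \<pi> V1 + sum \<pi> (boundary_out V E V1)) / sum \<pi> V1" if "V1 \<subseteq> V" for V1
    using that assms finite_subset[OF that]
    by (intro divide_nonneg_nonneg add_nonneg_nonneg sum_nonneg mult_nonneg_nonneg iota_inf_nonneg)
       (auto simp: boundary_out_def less_imp_le subset_iff)
  then show ?thesis
    unfolding h_out_def using assms by (subst Min_ge_iff) auto
qed

section \<open>Random rotation and level sets\<close>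

text \<open>\<open>B\<close> is the part of the bound that survives averaging over
  \<open>\<theta>\<close>. All subsets \<open>A'\<close> are covered by the same constants because a
  level set keeps only some neighbours and the constants must serve every level.\<close>

lemma round_phase_sup_bound:
  assumes k: "k \<ge> 1" and D: "0 \<le> D"
    and A: "\<And>y. y \<in> A \<Longrightarrow> s y \<in> roots_of_unity k \<and> cmod (z - s y * f y) \<le> D"
  obtains B c p q :: real where "0 \<le> B" "B * (cmod z)\<^sup>2 \<le> 2 * cmod z * D + D\<^sup>2"
    "\<And>\<theta> A'. A' \<subseteq> A \<Longrightarrow>
      sup_nonneg A' (\<lambda>y. cmod (round_phase k \<theta> z - s y * round_phase k \<theta> (f y)))
      \<le> B + c * ((\<lfloor>p + \<theta>\<rfloor> - p) - (\<lfloor>q + \<theta>\<rfloor> - q))"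
proof (cases "D < cmod z")
  case True
  define \<alpha> where "\<alpha> = arcsin (D / cmod z)"
  define u a where "u = k * Arg z / (2 * pi)" and "a = k * \<alpha> / (2 * pi)"
  have z: "cmod z > 0" using True D by linarith
  have d: "0 \<le> D / cmod z" "D / cmod z \<le> 1" using True D z by (auto simp: divide_simps)
  show thesis
  proof (rule that[of "4 * sin (\<alpha> / 2)" "2 * cos (\<alpha> / 2) * (pi / k)" "u + a" "u - a"])
    show "0 \<le> 4 * sin (\<alpha> / 2)"
      using d arcsin_bounded[of "D / cmod z"] arcsin_nonneg[of "D / cmod z"]
      by (auto simp: \<alpha>_def intro!: sin_ge_zero)
    have "4 * sin (\<alpha> / 2) * (cmod z)\<^sup>2 \<le> (2 * (D / cmod z) + (D / cmod z)\<^sup>2) * (cmod z)\<^sup>2"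
      unfolding \<alpha>_def by (intro mult_right_mono four_sin_half_arcsin_le d) auto
    also have "\<dots> = 2 * cmod z * D + D\<^sup>2" using z by (simp add: power2_eq_square field_simps)
    finally show "4 * sin (\<alpha> / 2) * (cmod z)\<^sup>2 \<le> 2 * cmod z * D + D\<^sup>2" .
    fix \<theta> A' assume A': "A' \<subseteq> A"
    let ?b = "4 * sin (\<alpha> / 2) + 2 * cos (\<alpha> / 2) * (pi / k) *
      ((\<lfloor>u + a + \<theta>\<rfloor> - (u + a)) - (\<lfloor>u - a + \<theta>\<rfloor> - (u - a)))"
    have le: "cmod (round_phase k \<theta> z - s' * round_phase k \<theta> w) \<le> ?b"
      if "s' \<in> roots_of_unity k" "cmod (z - s' * w) \<le> D" for s' w
      using round_phase_diff_le[OF k that True, of \<theta>]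
      unfolding u_def[symmetric] \<alpha>_def[symmetric] a_def[symmetric] by (simp add: algebra_simps)
    \<comment> \<open>With \<open>s' = 1\<close> and \<open>w = z\<close> the left side of
      \<open>le\<close> is 0; the sign of the bound matters when \<open>A'\<close> is empty.\<close>
    have "0 \<le> ?b" using le[of 1 z] D by (simp add: roots_of_unity_def)
    then show "sup_nonneg A' (\<lambda>y. cmod (round_phase k \<theta> z - s y * round_phase k \<theta> (f y))) \<le> ?b"
      using A A' by (intro sup_nonneg_le le) auto
  qed
next
  case False
  show thesis
  \<comment> \<open>Two numbers of modulus 1 are at distance at most 2, and
    \<open>cmod z \<le> D\<close> makes this crude bound affordable without any
    \<open>\<theta>\<close>-dependent term.\<close>
  proof (rule that[of 2 0 0 0])
    have "2 * (cmod z)\<^sup>2 \<le> 2 * (cmod z * D)"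
      using False by (simp add: power2_eq_square mult_left_mono)
    then show "2 * (cmod z)\<^sup>2 \<le> 2 * cmod z * D + D\<^sup>2" using zero_le_power2[of D] by linarith
    fix \<theta> A' assume A': "A' \<subseteq> A"
    have "cmod (round_phase k \<theta> z - s y * round_phase k \<theta> (f y)) \<le> 1 + 1" if "y \<in> A'" for y
      using that A A' root_of_unity_norm[OF k]
      by (intro order_trans[OF norm_triangle_ineq4] add_mono) (auto simp: norm_mult round_phase_def)
    then show "sup_nonneg A' (\<lambda>y. cmod (round_phase k \<theta> z - s y * round_phase k \<theta> (f y)))
      \<le> 2 + 0 * ((real_of_int \<lfloor>0 + \<theta>\<rfloor> - 0) - (real_of_int \<lfloor>0 + \<theta>\<rfloor> - 0))"
      by (intro sup_nonneg_le) auto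
  qed auto
qed

text \<open>The left side does not depend on \<open>\<theta>\<close> and every floor term has mean
  0, so integrating over \<open>\<theta>\<close> in \<open>[0, 1]\<close> removes all of them at
  once.\<close>

lemma floor_average_le:
  assumes fin: "finite A"
    and le: "\<And>\<theta>. b \<le> (\<Sum>x\<in>A. B x + c x * ((real_of_int \<lfloor>p x + \<theta>\<rfloor> - p x) - (real_of_int \<lfloor>q x + \<theta>\<rfloor> - q x)))"
  shows "b \<le> sum B A"
proof -
  have "((\<lambda>\<theta>. c x * ((real_of_int \<lfloor>p x + \<theta>\<rfloor> - p x) - (real_of_int \<lfloor>q x + \<theta>\<rfloor> - q x)))
      has_integral (c x * (0 - 0))) {0..1}" for x
    by (intro has_integral_mult_right has_integral_diff has_integral_floor_shift)
  then have S: "((\<lambda>\<theta>. \<Sum>x\<in>A. c x * ((real_of_int \<lfloor>p x + \<theta>\<rfloor> - p x) - (real_of_int \<lfloor>q x + \<theta>\<rfloor> - q x)))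
      has_integral (\<Sum>x\<in>A. c x * (0 - 0))) {0..1}"
    by (intro has_integral_sum fin)
  have C: "((\<lambda>\<theta>. b - sum B A) has_integral (b - sum B A)) {0..1::real}"
    using has_integral_const_real[of "b - sum B A" 0 1] unfolding content_real_if by simp
  have "b - sum B A \<le> (\<Sum>x\<in>A. c x * (0 - 0))"
    by (rule has_integral_le[OF C S]) (use le in \<open>simp only: sum.distrib diff_le_eq add.commute\<close>)
  then show ?thesis by simp
qed

text \<open>The factor 2 adds two equal costs, one for frustration and one for the outer boundary.
  \<open>D\<close> may be any bound on the edge differences at each vertex.\<close>

lemma h_out_rayleigh:
  fixes V :: "'v set" and D :: "'v \<Rightarrow> real"
  assumes k: "k \<ge> 1" and G: "finite_graph V E" and \<sigma>: "cyclic_connection k E \<sigma>"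
    and pos: "\<And>x. x \<in> V \<Longrightarrow> \<pi> x > 0" and D0: "\<And>x. x \<in> V \<Longrightarrow> 0 \<le> D x"
    and D: "\<And>x y. \<lbrakk>x \<in> V; y \<in> V; adj E y x\<rbrakk> \<Longrightarrow> cmod (f x - \<sigma> x y * f y) \<le> D x"
  shows "h_out k V E \<sigma> \<pi> * (\<Sum>x\<in>V. (cmod (f x))\<^sup>2 * \<pi> x)
    \<le> 2 * (\<Sum>x\<in>V. \<pi> x * (2 * cmod (f x) * D x + (D x)\<^sup>2))"
proof -
  let ?h = "h_out k V E \<sigma> \<pi>"
  have fin: "finite V" using G by (simp add: finite_graph_def)
  have root: "\<sigma> x y \<in> roots_of_unity k" if "adj E y x" for x y
  proof -
    have "(x, y) \<in> oriented_edges E"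
      using that by (simp add: oriented_edges_def adj_def insert_commute[of x y])
    then show ?thesis using \<sigma> unfolding cyclic_connection_def by fast
  qed
  \<comment> \<open>The constants are chosen per vertex, before \<open>\<theta>\<close> and before
    the level set.\<close>
  define P where "P x B c p q \<longleftrightarrow>
    0 \<le> B \<and> B * (cmod (f x))\<^sup>2 \<le> 2 * cmod (f x) * D x + (D x)\<^sup>2 \<and>
    (\<forall>\<theta>. \<forall>A' \<subseteq> {y\<in>V. adj E y x}.
      sup_nonneg A' (\<lambda>y. cmod (round_phase k \<theta> (f x) - \<sigma> x y * round_phase k \<theta> (f y)))
      \<le> B + c * ((real_of_int \<lfloor>p + \<theta>\<rfloor> - p) - (real_of_int \<lfloor>q + \<theta>\<rfloor> - q)))"
    for x and B c p q :: real
  have "\<exists>B c p q. P x B c p q" if x: "x \<in> V" for x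
  proof -
    have A: "\<sigma> x y \<in> roots_of_unity k \<and> cmod (f x - \<sigma> x y * f y) \<le> D x"
      if "y \<in> {y\<in>V. adj E y x}" for y
      using that x D root by auto
    show ?thesis
    proof (rule round_phase_sup_bound[where s = "\<sigma> x" and f = f, OF k D0[OF x] A])
      fix B c p q :: real
      assume B: "0 \<le> B" "B * (cmod (f x))\<^sup>2 \<le> 2 * cmod (f x) * D x + (D x)\<^sup>2"
      "\<And>\<theta> A'. A' \<subseteq> {y\<in>V. adj E y x} \<Longrightarrow>
        sup_nonneg A' (\<lambda>y. cmod (round_phase k \<theta> (f x) - \<sigma> x y * round_phase k \<theta> (f y)))
        \<le> B + c * ((real_of_int \<lfloor>p + \<theta>\<rfloor> - p) - (real_of_int \<lfloor>q + \<theta>\<rfloor> - q))"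
      show ?thesis
        by (rule exI[of _ B], rule exI[of _ c], rule exI[of _ p], rule exI[of _ q]) (unfold P_def, intro conjI allI impI B)
    qed
  qed
  then obtain B c p q :: "'v \<Rightarrow> real" where P: "\<And>x. x \<in> V \<Longrightarrow> P x (B x) (c x) (p x) (q x)"
    by metis
  \<comment> \<open>One angle \<open>\<theta>\<close> rounds all vertices of \<open>V1\<close>
    simultaneously; averaging it out leaves only \<open>B\<close>.\<close>
  have iota: "2 * iota_inf k E \<sigma> \<pi> V1 \<le> (\<Sum>x\<in>V1. B x * \<pi> x)" if V1: "V1 \<subseteq> V" for V1
  proof (rule floor_average_le)
    show fin1: "finite V1" using V1 fin by (rule finite_subset)
    fix \<theta>
    have "2 * iota_inf k E \<sigma> \<pi> V1 \<le> (\<Sum>x\<in>V1. sup_nonneg {y\<in>V1. adj E y x}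
        (\<lambda>y. cmod (round_phase k \<theta> (f x) - \<sigma> x y * round_phase k \<theta> (f y))) * \<pi> x)"
      by (rule iota_inf_le[OF fin1 k]) (rule round_phase_root[OF k])
    also have "\<dots> \<le> (\<Sum>x\<in>V1. (B x + c x * ((real_of_int \<lfloor>p x + \<theta>\<rfloor> - p x) - (real_of_int \<lfloor>q x + \<theta>\<rfloor> - q x))) * \<pi> x)"
    proof (intro sum_mono mult_right_mono)
      fix x assume "x \<in> V1"
      then have x: "x \<in> V" using V1 by auto
      show "sup_nonneg {y\<in>V1. adj E y x}
        (\<lambda>y. cmod (round_phase k \<theta> (f x) - \<sigma> x y * round_phase k \<theta> (f y)))
        \<le> B x + c x * ((real_of_int \<lfloor>p x + \<theta>\<rfloor> - p x) - (real_of_int \<lfloor>q x + \<theta>\<rfloor> - q x))"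
        by (rule P[OF x, unfolded P_def, THEN conjunct2, THEN conjunct2, rule_format]) (use V1 in auto)
      show "0 \<le> \<pi> x" using pos[OF x] by simp
    qed
    also have "\<dots> = (\<Sum>x\<in>V1. B x * \<pi> x + c x * \<pi> x * ((real_of_int \<lfloor>p x + \<theta>\<rfloor> - p x) - (real_of_int \<lfloor>q x + \<theta>\<rfloor> - q x)))"
      by (intro sum.cong) (auto simp: algebra_simps)
    finally show "2 * iota_inf k E \<sigma> \<pi> V1 \<le> \<dots>" .
  qed
  \<comment> \<open>The coarea inequality for \<open>|f|^2\<close> and \<open>(|f| + D)^2\<close>;
    the weights \<open>(?h - B x) * \<pi> x\<close> may have either sign.\<close>
  have "(\<Sum>x\<in>V. ((?h - B x) * \<pi> x) * (cmod (f x))\<^sup>2)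
      \<le> (\<Sum>x\<in>V. \<pi> x * ((cmod (f x) + D x)\<^sup>2 - (cmod (f x))\<^sup>2))"
  proof (rule sum_level_sets_le)
    show "(cmod (f x))\<^sup>2 \<le> (cmod (f x) + D x)\<^sup>2" if "x \<in> V" for x
      using D0[OF that] by (intro power_mono) auto
    fix t :: real assume "0 \<le> t"
    define V1 where "V1 = {x\<in>V. t < (cmod (f x))\<^sup>2}"
    have V1: "V1 \<subseteq> V" by (auto simp: V1_def)
    \<comment> \<open>A boundary vertex \<open>x\<close> is outside the level set but has a
      neighbour \<open>y\<close> inside, and \<open>|f y| \<le> |f x| + D x\<close> since
      \<open>\<sigma> x y\<close> has modulus 1.\<close>
    have bd: "boundary_out V E V1 \<subseteq> {x\<in>V. (cmod (f x))\<^sup>2 \<le> t \<and> t < (cmod (f x) + D x)\<^sup>2}"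
    proof
      fix x assume x: "x \<in> boundary_out V E V1"
      then obtain y where y: "y \<in> V" "t < (cmod (f y))\<^sup>2" "adj E y x"
        by (auto simp: boundary_out_def V1_def)
      have xV: "x \<in> V" using x by (auto simp: boundary_out_def)
      have "cmod (f y) = cmod (\<sigma> x y * f y)"
        by (simp add: norm_mult root_of_unity_norm[OF k root[OF y(3)]])
      also have "\<dots> \<le> cmod (f x) + cmod (f x - \<sigma> x y * f y)"
        using norm_triangle_ineq4[of "f x" "f x - \<sigma> x y * f y"] by simp
      also have "\<dots> \<le> cmod (f x) + D x" using D[OF xV y(1,3)] by simp
      finally have "(cmod (f y))\<^sup>2 \<le> (cmod (f x) + D x)\<^sup>2" by (intro power_mono) auto
      with x y show "x \<in> {x\<in>V. (cmod (f x))\<^sup>2 \<le> t \<and> t < (cmod (f x) + D x)\<^sup>2}"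
        by (auto simp: boundary_out_def V1_def)
    qed
    have "?h * sum \<pi> V1 \<le> 2 * iota_inf k E \<sigma> \<pi> V1 + sum \<pi> (boundary_out V E V1)"
    \<comment> \<open>\<open>h_out\<close> minimises over nonempty sets only; for an empty level set
      every term vanishes, \<open>iota_inf\<close> being a minimum of empty sums.\<close>
    proof (cases "V1 = {}")
      case True
      then show ?thesis by (simp add: boundary_out_def iota_inf_def)
    qed (use V1 fin pos in \<open>intro h_out_le\<close>)
    also have "\<dots> \<le> (\<Sum>x\<in>V1. B x * \<pi> x) +
        sum \<pi> {x\<in>V. (cmod (f x))\<^sup>2 \<le> t \<and> t < (cmod (f x) + D x)\<^sup>2}"
      using bd fin pos by (intro add_mono iota V1 sum_mono2) (auto simp: less_imp_le)
    finally have "(\<Sum>x\<in>V1. (?h - B x) * \<pi> x) \<le>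
        sum \<pi> {x\<in>V. (cmod (f x))\<^sup>2 \<le> t \<and> t < (cmod (f x) + D x)\<^sup>2}"
      by (simp add: left_diff_distrib sum_subtractf sum_distrib_left)
    then show "(\<Sum>x\<in>V. if t < (cmod (f x))\<^sup>2 then (?h - B x) * \<pi> x else 0)
        \<le> (\<Sum>x\<in>V. if (cmod (f x))\<^sup>2 \<le> t \<and> t < (cmod (f x) + D x)\<^sup>2 then \<pi> x else 0)"
      by (simp only: V1_def sum.inter_filter[OF fin])
  qed simp
  also have "\<dots> = (\<Sum>x\<in>V. \<pi> x * (2 * cmod (f x) * D x + (D x)\<^sup>2))"
    by (simp add: power2_eq_square algebra_simps)
  finally have "?h * (\<Sum>x\<in>V. (cmod (f x))\<^sup>2 * \<pi> x) - (\<Sum>x\<in>V. \<pi> x * (B x * (cmod (f x))\<^sup>2))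
      \<le> (\<Sum>x\<in>V. \<pi> x * (2 * cmod (f x) * D x + (D x)\<^sup>2))"
    by (simp add: algebra_simps sum_subtractf sum_distrib_left)
  moreover have "(\<Sum>x\<in>V. \<pi> x * (B x * (cmod (f x))\<^sup>2))
      \<le> (\<Sum>x\<in>V. \<pi> x * (2 * cmod (f x) * D x + (D x)\<^sup>2))"
    using P[unfolded P_def] pos by (intro sum_mono mult_left_mono) (auto simp: less_imp_le)
  ultimately show ?thesis by linarith
qed

section \<open>The spectral estimate\<close>

theorem theorem6p4:
  fixes k :: nat and V :: "'v set" and E :: "'v set set"
    and \<sigma> :: "'v \<Rightarrow> 'v \<Rightarrow> complex" and \<pi> :: "'v \<Rightarrow> real"
  assumes "k \<ge> 1"
    and "finite_graph V E"
    and "cyclic_connection k E \<sigma>"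
    and "\<And>x. x \<in> V \<Longrightarrow> \<pi> x > 0"
  shows "lambda_inf V E \<sigma> \<pi> \<ge> (sqrt (1 + 1 / 2 * h_out k V E \<sigma> \<pi>) - 1)\<^sup>2"
proof (rule lambda_inf_greatest(2)[OF assms(2,4)])
  let ?h = "h_out k V E \<sigma> \<pi>"
  \<comment> \<open>\<open>c\<close> is the nonnegative root of \<open>c^2 + 2 * c = ?h / 2\<close>,
    and admissibility of \<open>c^2\<close> is what is left to prove.\<close>
  define c where "c = sqrt (1 + 1 / 2 * ?h) - 1"
  have fin: "finite V" "V \<noteq> {}" using assms by (auto simp: finite_graph_def)
  have h: "0 \<le> ?h" by (rule h_out_nonneg[OF fin assms(1,4)])
  have c0: "0 \<le> c" using h by (simp add: c_def)
  have "(c + 1)\<^sup>2 = 1 + 1 / 2 * ?h" using h by (simp add: c_def)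
  then have hc: "?h = 2 * (c\<^sup>2 + 2 * c)" by (simp add: power2_eq_square algebra_simps)
  show "lambda_inf_admissible V E \<sigma> \<pi> (c\<^sup>2)"
    unfolding lambda_inf_admissible_def
  proof
    fix f :: "'v \<Rightarrow> complex"
    let ?R = "\<lambda>x. sup_nonneg {y\<in>V. adj E y x} (\<lambda>y. (cmod (f x - \<sigma> x y * f y))\<^sup>2)"
    define N R where "N = (\<Sum>x\<in>V. (cmod (f x))\<^sup>2 * \<pi> x)" and "R = (\<Sum>x\<in>V. ?R x * \<pi> x)"
    have R0: "0 \<le> ?R x" for x using fin by (intro sup_nonneg_nonneg) auto
    have R_nn: "0 \<le> R" using R0 assms(4) by (auto simp: R_def less_imp_le intro!: sum_nonneg mult_nonneg_nonneg)
    have "c\<^sup>2 * N \<le> R"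
    \<comment> \<open>The case \<open>c = 0\<close> is split off because the weighted mean
      inequality below divides by \<open>c\<close>.\<close>
    proof (cases "c = 0")
      case True
      then show ?thesis using R_nn by simp
    next
      case False
      then have c: "c > 0" using c0 by simp
      \<comment> \<open>The square root of the supremum of squares is the bound used for
        \<open>D\<close>.\<close>
      have "?h * N \<le> 2 * (\<Sum>x\<in>V. \<pi> x * (2 * cmod (f x) * sqrt (?R x) + (sqrt (?R x))\<^sup>2))"
        unfolding N_def
      proof (rule h_out_rayleigh[OF assms])
        fix x y assume "x \<in> V" "y \<in> V" "adj E y x"
        then have "(cmod (f x - \<sigma> x y * f y))\<^sup>2 \<le> ?R x" using fin by (intro sup_nonneg_ge) auto
        then show "cmod (f x - \<sigma> x y * f y) \<le> sqrt (?R x)" by (rule real_le_rsqrt)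
      qed (use R0 in auto)
      also have "\<dots> \<le> 2 * (\<Sum>x\<in>V. \<pi> x * (c * (cmod (f x))\<^sup>2 + ?R x / c + ?R x))"
      proof (intro mult_left_mono sum_mono)
        fix x assume "x \<in> V"
        then show "0 \<le> \<pi> x" using assms(4) by (simp add: less_imp_le)
        \<comment> \<open>Arithmetic-geometric mean with weight \<open>c\<close>: it makes
          \<open>1 + c\<close> a common factor of both sides in the end, leaving exactly
          \<open>c^2 * N \<le> R\<close>.\<close>
        have "0 \<le> (c * cmod (f x) - sqrt (?R x))\<^sup>2 / c" using c by simp
        also have "\<dots> = c * (cmod (f x))\<^sup>2 + (sqrt (?R x))\<^sup>2 / c - 2 * cmod (f x) * sqrt (?R x)"
          using c by (simp only: power2_eq_square) (simp add: field_simps)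
        finally show "2 * cmod (f x) * sqrt (?R x) + (sqrt (?R x))\<^sup>2 \<le> c * (cmod (f x))\<^sup>2 + ?R x / c + ?R x"
          using R0[of x] by simp
      qed simp
      also have "\<dots> = 2 * (c * N + R / c + R)"
        by (simp add: N_def R_def sum.distrib sum_distrib_left sum_divide_distrib algebra_simps)
      finally have "(c\<^sup>2 + c) * N \<le> R / c + R" by (simp only: hc distrib_left distrib_right)
      then have "c * ((c\<^sup>2 + c) * N) \<le> c * (R / c + R)"
        using c by (intro mult_left_mono) auto
      also have "\<dots> = (1 + c) * R" using c by (simp add: field_simps)
      finally have "(1 + c) * (c\<^sup>2 * N) \<le> (1 + c) * R" by (simp add: power2_eq_square algebra_simps)
      then show ?thesis using c by simp
    qed
    then show "c\<^sup>2 * (\<Sum>x\<in>V. (cmod (f x))\<^sup>2 * \<pi> x) \<le> (\<Sum>x\<in>V. ?R x * \<pi> x)"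
      by (simp add: N_def R_def)
  qed
qed

end
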